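(* Statement (A) implies statement (G), where: (A) The group $\mathrm{ISO}(\mathbb{U})$ of isometries of the Urysohn space $\mathbb{U}$ contains an everywhere dense locally finite subgroup, and the group $\mathrm{ISO}(\mathbb{QU})$ of isometries of the rational Urysohn space $\mathbb{QU}$ contains an everywhere dense locally finite subgroup. (G) For every finite metric space $(F,\rho)$ there exist a finite metric space $(F',\rho')$, an isometric embedding $I:(F,\rho)\to(F',\rho')$ and a map $T:\mathrm{PISO}(F)\to \mathrm{ISO}(F')$ such that: 1. for each partial isometry $h\in \mathrm{PISO}(F)$, the isometry $T(h)$ of $F'$ extends $h$, i.e. $I(hx)=[T(h)](Ix)$ for all $x$ in the domain of $h$; 2. for each subset $K\subset F$ (in particular for $K=F$) the restriction of $T$ to the group $\mathrm{ISO}(K)\subset \mathrm{PISO}(F)$ is a group homomorphism $\mathrm{ISO}(K)\to \mathrm{ISO}(F')$, i.e. $T(g_1g_2)=T(g_1)T(g_2)$ for all $g_1,g_2\in \mathrm{ISO}(K)$.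
   Context: For a metric space $X$, $\mathrm{ISO}(X)$ is the group of all isometries of $X$ onto itself. A partial isometry of $X$ is a distance-preserving bijection from one subset of $X$ onto another subset of $X$ (the empty map, with empty domain, is allowed); $\mathrm{PISO}(X)$ is the set of all partial isometries of $X$. For $K\subset X$ (with the induced metric), elements of $\mathrm{ISO}(K)$ are regarded as partial isometries of $X$ with domain and range $K$. The Urysohn space $\mathbb{U}$ is the (unique up to isometry) complete separable metric space that contains an isometric copy of every separable metric space and is ultrahomogeneous: every isometry between two finite subsets extends to an isometry of the whole space onto itself. The rational Urysohn space $\mathbb{QU}$ is the (unique up to isometry) countable metric space with rational distances that contains an isometric copy of every finite metric space with rational distances and is ultrahomogeneous in the same sense. A group is locally finite if each of its finitely generated subgroups is finite. Density in $\mathrm{ISO}(\mathbb{U})$ is with respect to the topology of pointwise convergence on $\mathbb{U}$. Density in $\mathrm{ISO}(\mathbb{QU})$ is with respect to pointwise convergence with $\mathbb{QU}$ regarded as a discrete set: a subgroup $H$ is dense if for every $g\in\mathrm{ISO}(\mathbb{QU})$ and every finite $E\subset\mathbb{QU}$ there is $h\in H$ with $h(x)=g(x)$ for all $x\in E$. *)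

theory Defs
  imports "HOL-Analysis.Analysis" "HOL-Algebra.Bij" "HOL-Algebra.Generated_Groups"
begin

section \<open>Isometries\<close>

definition isometric_embedding :: "'a metric \<Rightarrow> 'b metric \<Rightarrow> ('a \<Rightarrow> 'b) \<Rightarrow> bool" where
  "isometric_embedding m1 m2 f \<longleftrightarrow>
     f \<in> mspace m1 \<rightarrow> mspace m2 \<and>
     (\<forall>x\<in>mspace m1. \<forall>y\<in>mspace m1. mdist m2 (f x) (f y) = mdist m1 x y)"

definition isometry_onto :: "'a metric \<Rightarrow> 'b metric \<Rightarrow> ('a \<Rightarrow> 'b) \<Rightarrow> bool" where
  "isometry_onto m1 m2 f \<longleftrightarrow>
     bij_betw f (mspace m1) (mspace m2) \<and>
     (\<forall>x\<in>mspace m1. \<forall>y\<in>mspace m1. mdist m2 (f x) (f y) = mdist m1 x y)"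

text \<open>As in \<^const>\<open>BijGroup\<close>, elements are functions that are extensional on the space.\<close>

definition ISO :: "'a metric \<Rightarrow> ('a \<Rightarrow> 'a) monoid" where
  "ISO m = (BijGroup (mspace m))
     \<lparr>carrier := {f \<in> carrier (BijGroup (mspace m)). isometry_onto m m f}\<rparr>"

lemma carrier_ISO: "carrier (ISO m) = {f \<in> extensional (mspace m). isometry_onto m m f}"
  by (auto simp: ISO_def BijGroup_def Bij_def isometry_onto_def)

lemma one_ISO: "\<one>\<^bsub>ISO m\<^esub> = (\<lambda>x\<in>mspace m. x)"
  by (simp add: ISO_def BijGroup_def)

lemma mult_ISO:
  assumes "f \<in> carrier (ISO m)" "g \<in> carrier (ISO m)"
  shows "f \<otimes>\<^bsub>ISO m\<^esub> g = compose (mspace m) f g"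
  using assms by (simp add: ISO_def BijGroup_def)

lemma group_ISO: "group (ISO m)"
proof -
  let ?B = "BijGroup (mspace m)"
  interpret B: group ?B by (rule group_BijGroup)
  have "subgroup {f \<in> carrier ?B. isometry_onto m m f} ?B"
  proof (rule B.subgroupI)
    show "{f \<in> carrier ?B. isometry_onto m m f} \<noteq> {}"
      using id_Bij[of "mspace m"]
      by (auto simp: BijGroup_def isometry_onto_def Bij_def intro!: exI[of _ "\<lambda>x\<in>mspace m. x"])
  next
    fix f assume f: "f \<in> {f \<in> carrier ?B. isometry_onto m m f}"
    then have fB: "f \<in> Bij (mspace m)"
      and d: "\<And>x y. x \<in> mspace m \<Longrightarrow> y \<in> mspace m \<Longrightarrow> mdist m (f x) (f y) = mdist m x y"
      by (auto simp: BijGroup_def isometry_onto_def)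
    have bij: "bij_betw f (mspace m) (mspace m)" using fB by (simp add: Bij_def)
    define g where "g = (\<lambda>x\<in>mspace m. inv_into (mspace m) f x)"
    have g: "inv\<^bsub>?B\<^esub> f = g" unfolding g_def by (rule inv_BijGroup[OF fB])
    have gB: "g \<in> Bij (mspace m)" unfolding g_def by (rule restrict_inv_into_Bij[OF fB])
    have gb: "bij_betw g (mspace m) (mspace m)" using gB by (simp add: Bij_def)
    have fg: "f (g x) = x" if "x \<in> mspace m" for x
      using that bij by (simp add: g_def bij_betw_inv_into_right)
    have "mdist m (g x) (g y) = mdist m x y" if "x \<in> mspace m" "y \<in> mspace m" for x y
      using d[of "g x" "g y"] that fg gb by (auto dest: bij_betwE)
    then show "inv\<^bsub>?B\<^esub> f \<in> {f \<in> carrier ?B. isometry_onto m m f}"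
      using g gB gb by (simp add: BijGroup_def isometry_onto_def)
  next
    fix f g assume f: "f \<in> {f \<in> carrier ?B. isometry_onto m m f}"
      and g: "g \<in> {f \<in> carrier ?B. isometry_onto m m f}"
    then have "compose (mspace m) f g \<in> Bij (mspace m)"
      by (auto simp: BijGroup_def intro: compose_Bij)
    then show "f \<otimes>\<^bsub>?B\<^esub> g \<in> {f \<in> carrier ?B. isometry_onto m m f}"
      using f g by (auto simp: BijGroup_def isometry_onto_def Bij_def compose_eq dest!: bij_betwE)
  qed (auto)
  from B.subgroup_imp_group[OF this] show ?thesis by (simp add: ISO_def)
qed

definition PISO :: "'a metric \<Rightarrow> ('a \<rightharpoonup> 'a) set" where
  "PISO m = {h. dom h \<subseteq> mspace m \<and> ran h \<subseteq> mspace m \<and>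
     isometry_onto (submetric m (dom h)) (submetric m (ran h)) (the \<circ> h)}"

definition as_partial :: "'a set \<Rightarrow> ('a \<Rightarrow> 'a) \<Rightarrow> ('a \<rightharpoonup> 'a)" where
  "as_partial K g = (\<lambda>x. if x \<in> K then Some (g x) else None)"

lemma as_partial_image_ISO:
  assumes "K \<subseteq> mspace m"
  shows "as_partial K ` carrier (ISO (submetric m K)) = {h \<in> PISO m. dom h = K \<and> ran h = K}"
proof (intro equalityI subsetI)
  fix h assume "h \<in> as_partial K ` carrier (ISO (submetric m K))"
  then obtain g where h: "h = as_partial K g" and g: "g \<in> carrier (ISO (submetric m K))" by blast
  have K: "K \<inter> mspace m = K" using assms by blast
  have b: "bij_betw g K K"
    and d: "\<And>x y. x \<in> K \<Longrightarrow> y \<in> K \<Longrightarrow> mdist m (g x) (g y) = mdist m x y"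
    using g by (auto simp: carrier_ISO isometry_onto_def K)
  have dom: "dom h = K" by (auto simp: h as_partial_def dom_def)
  have ran: "ran h = K"
  proof -
    have "ran h = g ` K" by (auto simp: h as_partial_def ran_def)
    then show ?thesis using b by (simp add: bij_betw_def)
  qed
  have "bij_betw (the \<circ> h) K K"
    using b by (subst bij_betw_cong[of K _ g]) (auto simp: h as_partial_def)
  then show "h \<in> {h \<in> PISO m. dom h = K \<and> ran h = K}"
    using assms d by (auto simp: PISO_def dom ran isometry_onto_def K) (auto simp: h as_partial_def)
next
  fix h assume "h \<in> {h \<in> PISO m. dom h = K \<and> ran h = K}"
  then have h: "h \<in> PISO m" and dom: "dom h = K" and ran: "ran h = K" by auto
  have K: "K \<inter> mspace m = K" using assms by blast
  define g where "g = restrict (the \<circ> h) K"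
  have b: "bij_betw (the \<circ> h) K K"
    and d: "\<And>x y. x \<in> K \<Longrightarrow> y \<in> K \<Longrightarrow> mdist m (the (h x)) (the (h y)) = mdist m x y"
    using h by (auto simp: PISO_def isometry_onto_def dom ran K)
  have "bij_betw g K K" using b by (subst bij_betw_cong[of K _ "the \<circ> h"]) (auto simp: g_def)
  then have "g \<in> carrier (ISO (submetric m K))"
    using d by (auto simp: carrier_ISO isometry_onto_def K g_def)
  moreover have "h = as_partial K g"
    using dom by (auto simp: as_partial_def g_def fun_eq_iff)
  ultimately show "h \<in> as_partial K ` carrier (ISO (submetric m K))" by blast
qed

lemma as_partial_mult:
  assumes "K \<subseteq> mspace m" "f \<in> carrier (ISO (submetric m K))" "g \<in> carrier (ISO (submetric m K))"
  shows "as_partial K (f \<otimes>\<^bsub>ISO (submetric m K)\<^esub> g) = as_partial K f \<circ>\<^sub>m as_partial K g"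
proof -
  have K: "K \<inter> mspace m = K" using assms by blast
  have "g x \<in> K" if "x \<in> K" for x
    using assms(3) that by (auto simp: carrier_ISO isometry_onto_def K dest: bij_betwE)
  then show ?thesis
    by (auto simp: mult_ISO[OF assms(2,3)] as_partial_def map_comp_def compose_def K fun_eq_iff)
qed

section \<open>The Urysohn space and the rational Urysohn space\<close>

definition ultrahomogeneous :: "'a metric \<Rightarrow> bool" where
  "ultrahomogeneous m \<longleftrightarrow>
     (\<forall>h\<in>PISO m. finite (dom h) \<longrightarrow> (\<exists>g\<in>carrier (ISO m). \<forall>x\<in>dom h. g x = the (h x)))"

definition rational_metric :: "'a metric \<Rightarrow> bool" where
  "rational_metric m \<longleftrightarrow> (\<forall>x\<in>mspace m. \<forall>y\<in>mspace m. mdist m x y \<in> \<rat>)"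

text \<open>
  A definition cannot quantify over all types, so universality is required for metric
  spaces on subsets of the reals, respectively of the naturals. This loses nothing: a separable
  metric space has at most continuum many points. See \<open>urysohn_space_universal\<close> and
  \<open>rational_urysohn_space_universal\<close> below, which are stated for an arbitrary type.
\<close>

definition urysohn_space :: "'a metric \<Rightarrow> bool" where
  "urysohn_space m \<longleftrightarrow>
     mcomplete_of m \<and> separable_space (mtopology_of m) \<and> ultrahomogeneous m \<and>
     (\<forall>X :: real metric. separable_space (mtopology_of X) \<longrightarrow> (\<exists>f. isometric_embedding X m f))"

definition rational_urysohn_space :: "'a metric \<Rightarrow> bool" where
  "rational_urysohn_space m \<longleftrightarrow>
     countable (mspace m) \<and> rational_metric m \<and> ultrahomogeneous m \<and>
     (\<forall>X :: nat metric. finite (mspace X) \<and> rational_metric X \<longrightarrow>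
        (\<exists>f. isometric_embedding X m f))"

lemma metric_transport:
  fixes X :: "'a metric" and e :: "'a \<Rightarrow> 'b"
  assumes "inj_on e (mspace X)"
  obtains Y where "mspace Y = e ` mspace X" "isometry_onto X Y e"
proof -
  let ?i = "inv_into (mspace X) e"
  interpret X: Metric_space "mspace X" "mdist X" by simp
  let ?d = "\<lambda>x y. mdist X (if x \<in> e ` mspace X then ?i x else undefined)
                          (if y \<in> e ` mspace X then ?i y else undefined)"
  have M: "Metric_space (e ` mspace X) ?d"
    by unfold_locales (use assms X.commute X.triangle in \<open>auto simp: inv_into_f_f\<close>)
  show thesis
  proof
    show "mspace (metric (e ` mspace X, ?d)) = e ` mspace X"
      by (rule Metric_space.mspace_metric[OF M])
    then show "isometry_onto X (metric (e ` mspace X, ?d)) e"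
      using assms by (auto simp: isometry_onto_def bij_betw_def Metric_space.mdist_metric[OF M])
  qed
qed

lemma isometry_onto_homeomorphic:
  assumes "isometry_onto X Y e"
  shows "mtopology_of X homeomorphic_space mtopology_of Y"
proof -
  interpret Metric_space12 "mspace X" "mdist X" "mspace Y" "mdist Y"
    by (simp add: Metric_space12_def)
  have "homeomorphic_map M1.mtopology M2.mtopology e"
    using assms
    by (intro isometry_imp_homeomorphic_map) (auto simp: isometry_onto_def bij_betw_def)
  then show ?thesis
    unfolding mtopology_of_def by (rule homeomorphic_map_imp_homeomorphic_space)
qed

lemma separable_metric_inj_real:
  fixes X :: "'a metric"
  assumes "separable_space (mtopology_of X)"
  obtains e :: "'a \<Rightarrow> real" where "inj_on e (mspace X)"
proof -
  interpret X: Metric_space "mspace X" "mdist X" by simp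
  obtain C where C: "countable C" "C \<subseteq> mspace X" "mtopology_of X closure_of C = mspace X"
    using assms by (auto simp: separable_space_def)
  define s where "s = from_nat_into C"
  define q where "q = (from_nat :: nat \<Rightarrow> rat)"
  define A where "A x = {k. mdist X x (s (fst (prod_decode k))) < of_rat (q (snd (prod_decode k)))}"
    for x
  have inj: "inj_on A (mspace X)"
  proof (rule inj_onI, rule ccontr)
    fix x y assume xy: "x \<in> mspace X" "y \<in> mspace X" "A x = A y" "x \<noteq> y"
    then have "mdist X x y > 0" by simp
    then obtain r where r: "0 < real_of_rat r" "of_rat r < mdist X x y / 2"
      using of_rat_dense[of 0 "mdist X x y / 2"] by (metis half_gt_zero)
    have "x \<in> X.mtopology closure_of C" using C(3) xy(1) by (simp add: mtopology_of_def)
    then obtain c where c: "c \<in> C" "mdist X x c < of_rat r"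
      using r(1) unfolding X.metric_closure_of by (auto simp del: zero_less_of_rat_iff)
    then have cX: "c \<in> mspace X" using C(2) by blast
    obtain n where n: "s n = c"
      using from_nat_into_surj[OF C(1) c(1)] by (auto simp: s_def)
    have qn: "q (to_nat r) = r" by (simp add: q_def)
    have "prod_encode (n, to_nat r) \<in> A x" using c(2) by (simp add: A_def n qn)
    then have "prod_encode (n, to_nat r) \<in> A y" by (simp add: xy(3))
    then have "mdist X y c < of_rat r" by (simp add: A_def n qn)
    then show False
      using X.triangle[OF xy(1) cX xy(2)] c(2) r(2) X.commute[of c y] by simp
  qed
  obtain b :: "nat set \<Rightarrow> real" where b: "bij b"
    using nat_sets_eqpoll_reals by (auto simp: eqpoll_def)
  have "inj_on (b \<circ> A) (mspace X)"
    using inj b by (intro comp_inj_on) (auto simp: bij_def intro: inj_on_subset)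
  then show thesis by (rule that)
qed

lemma isometric_embedding_compose:
  assumes "isometry_onto X Y e" "isometric_embedding Y Z f"
  shows "isometric_embedding X Z (f \<circ> e)"
proof -
  have "e x \<in> mspace Y" if "x \<in> mspace X" for x
    using assms(1) that by (auto simp: isometry_onto_def dest: bij_betwE)
  then show ?thesis
    using assms by (simp add: isometric_embedding_def isometry_onto_def Pi_iff)
qed

theorem urysohn_space_universal:
  fixes X :: "'b metric"
  assumes "urysohn_space m" "separable_space (mtopology_of X)"
  shows "\<exists>f. isometric_embedding X m f"
proof -
  obtain e :: "'b \<Rightarrow> real" where "inj_on e (mspace X)"
    using separable_metric_inj_real[OF assms(2)] .
  then obtain Y where Y: "isometry_onto X Y e" by (rule metric_transport)
  have "separable_space (mtopology_of Y)"
    using homeomorphic_separable_space[OF isometry_onto_homeomorphic[OF Y]] assms(2) by simp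
  then show ?thesis
    using assms(1) Y isometric_embedding_compose unfolding urysohn_space_def by blast
qed

theorem rational_urysohn_space_universal:
  fixes X :: "'b metric"
  assumes "rational_urysohn_space m" "finite (mspace X)" "rational_metric X"
  shows "\<exists>f. isometric_embedding X m f"
proof -
  obtain e :: "'b \<Rightarrow> nat" where "inj_on e (mspace X)"
    using finite_imp_inj_to_nat_seg[OF assms(2)] by blast
  then obtain Y where Y: "mspace Y = e ` mspace X" "isometry_onto X Y e"
    by (rule metric_transport)
  have "finite (mspace Y)" "rational_metric Y"
    using assms(2,3) Y by (auto simp: rational_metric_def isometry_onto_def)
  then show ?thesis
    using assms(1) Y(2) isometric_embedding_compose unfolding rational_urysohn_space_def by blast
qed

section \<open>Dense locally finite subgroups\<close>

definition locally_finite_group :: "('a, 'b) monoid_scheme \<Rightarrow> bool" where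
  "locally_finite_group G \<longleftrightarrow>
     group G \<and> (\<forall>S. finite S \<and> S \<subseteq> carrier G \<longrightarrow> finite (generate G S))"

text \<open>Pointwise convergence of isometries of \<open>m\<close>, with respect to a topology \<open>X\<close> on its points.\<close>

definition ISO_topology :: "'a topology \<Rightarrow> 'a metric \<Rightarrow> ('a \<Rightarrow> 'a) topology" where
  "ISO_topology X m = subtopology (product_topology (\<lambda>_. X) (mspace m)) (carrier (ISO m))"

definition has_dense_locally_finite_subgroup :: "'a topology \<Rightarrow> 'a metric \<Rightarrow> bool" where
  "has_dense_locally_finite_subgroup X m \<longleftrightarrow>
     (\<exists>H. subgroup H (ISO m) \<and> locally_finite_group (ISO m\<lparr>carrier := H\<rparr>) \<and>
          ISO_topology X m closure_of H = carrier (ISO m))"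

lemma topspace_ISO_topology:
  assumes "topspace X = mspace m"
  shows "topspace (ISO_topology X m) = carrier (ISO m)"
  using assms
  by (auto simp: ISO_topology_def carrier_ISO isometry_onto_def PiE_iff extensional_def
      dest: bij_betwE)

lemma dense_ISO_discrete:
  assumes "H \<subseteq> carrier (ISO m)"
  shows "ISO_topology (discrete_topology (mspace m)) m closure_of H = carrier (ISO m) \<longleftrightarrow>
    (\<forall>g\<in>carrier (ISO m). \<forall>E. finite E \<and> E \<subseteq> mspace m \<longrightarrow> (\<exists>h\<in>H. \<forall>x\<in>E. h x = g x))"
    (is "?l \<longleftrightarrow> ?r")
proof -
  let ?P = "product_topology (\<lambda>_. discrete_topology (mspace m)) (mspace m)"
  have maps: "g x \<in> mspace m" if "g \<in> carrier (ISO m)" "x \<in> mspace m" for g x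
    using that by (auto simp: carrier_ISO isometry_onto_def dest: bij_betwE)
  have ext: "g \<in> PiE (mspace m) (\<lambda>_. mspace m)" if "g \<in> carrier (ISO m)" for g
    using that maps[OF that] by (auto simp: carrier_ISO PiE_iff)
  have cl: "ISO_topology (discrete_topology (mspace m)) m closure_of H
      = carrier (ISO m) \<inter> ?P closure_of H"
    unfolding ISO_topology_def using assms
    by (simp add: closure_of_subtopology inf_absorb2)
  have "?l \<longleftrightarrow> (\<forall>g\<in>carrier (ISO m). g \<in> ?P closure_of H)" unfolding cl by blast
  also have "\<dots> \<longleftrightarrow> ?r"
  proof (intro ball_cong refl iffI allI impI)
    fix g E assume g: "g \<in> carrier (ISO m)" "g \<in> ?P closure_of H"
      and E: "finite E \<and> E \<subseteq> mspace m"
    let ?W = "PiE (mspace m) (\<lambda>x. if x \<in> E then {g x} else mspace m)"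
    have "finite {x \<in> mspace m. (if x \<in> E then {g x} else mspace m) \<noteq> mspace m}"
      by (rule finite_subset[of _ E]) (use E in \<open>auto split: if_splits\<close>)
    then have "openin ?P ?W"
      by (auto simp: openin_PiE_gen maps[OF g(1)])
    moreover have "g \<in> ?W" using ext[OF g(1)] by (auto simp: PiE_iff)
    ultimately obtain h where h: "h \<in> H" "h \<in> ?W" using g(2) by (auto simp: in_closure_of)
    then have "\<forall>x\<in>E. h x = g x" using E by (auto simp: PiE_iff split: if_splits)
    then show "\<exists>h\<in>H. \<forall>x\<in>E. h x = g x" using h(1) by blast
  next
    fix g assume g: "g \<in> carrier (ISO m)"
      and a: "\<forall>E. finite E \<and> E \<subseteq> mspace m \<longrightarrow> (\<exists>h\<in>H. \<forall>x\<in>E. h x = g x)"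
    show "g \<in> ?P closure_of H"
      unfolding in_closure_of
    proof (intro conjI allI impI)
      show "g \<in> topspace ?P" using ext[OF g] by simp
      fix W assume "g \<in> W \<and> openin ?P W"
      then obtain V where V: "finite {i \<in> mspace m. V i \<noteq> mspace m}"
          "g \<in> PiE (mspace m) V" "PiE (mspace m) V \<subseteq> W"
        unfolding openin_product_topology_alt by force
      obtain h where h: "h \<in> H" "\<forall>x\<in>{i \<in> mspace m. V i \<noteq> mspace m}. h x = g x"
        using a V(1) by blast
      have "h x \<in> V x" if "x \<in> mspace m" for x
        using that h V(2) maps[of h x] assms by (cases "V x = mspace m") (auto simp: PiE_iff)
      then have "h \<in> PiE (mspace m) V" using ext[of h] h(1) assms by (auto simp: PiE_iff)
      then show "\<exists>y. y \<in> H \<and> y \<in> W" using h(1) V(3) by blast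
    qed
  qed
  finally show ?thesis .
qed

end

theory Submission
  imports Defs
begin

text \<open>
  Suppose first that the distances of \<open>F\<close> are rational, and place \<open>F\<close> in \<open>QU\<close>. Each of the
  finitely many partial isometries \<open>h\<close> of \<open>F\<close> extends to an isometry of \<open>QU\<close> by
  ultrahomogeneity, and density, which is with respect to the discrete topology, gives an element
  \<open>s h\<close> of the locally finite subgroup that agrees with \<open>h\<close> exactly. The \<open>s h\<close> generate a
  finite group \<open>\<Gamma>\<close>, so the union of the translates of \<open>F\<close> under \<open>\<Gamma>\<close> is a finite space
  to whose isometries all partial isometries extend. The trouble is that \<open>s\<close> need not be
  multiplicative on \<open>ISO(K)\<close>, and the surjection onto \<open>ISO(K)\<close> from the subgroup of \<open>\<Gamma>\<close>
  preserving \<open>K\<close> need not split.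

  The remedy is to pass to functions on \<open>\<Gamma>\<close>. A point \<open>x\<close> becomes the function
  \<open>\<gamma> \<mapsto> \<gamma> x\<close>, and every permutation \<open>\<sigma>\<close> of \<open>\<Gamma>\<close> acts isometrically on functions by
  \<open>f \<mapsto> f \<circ> \<sigma>\<close>. This action extends \<open>h\<close> as soon as \<open>\<sigma> \<gamma>\<close> and \<open>\<gamma> \<circ> h\<close> agree on the
  domain of \<open>h\<close>, a condition that only concerns the restriction of \<open>\<sigma> \<gamma>\<close> to that domain.
  Right multiplication by \<open>s h\<close> is one such \<open>\<sigma>\<close>, and its existence makes the relevant fibres of
  the restriction map equinumerous. Hence one may number the elements of every fibre once and for
  all and take the \<open>\<sigma>\<close> that preserves these numbers. With this choice \<open>\<sigma>\<close> is determined by \<open>h\<close>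
  in a way that respects composition (\<open>coherent_reindexing\<close>), and
  \<open>globalization_of_embedding_family\<close> turns this into the required extension.

  For real distances, \<open>\<lceil>N d\<rceil>\<close> is again a metric on \<open>F\<close>, because \<open>\<lceil>\<cdot>\<rceil>\<close> is subadditive, and
  partial isometries for \<open>d\<close> remain partial isometries for it. For large \<open>N\<close> there is a
  subadditive monotone function \<open>\<phi>\<close> with \<open>\<phi> \<lceil>N d\<rceil> = d\<close> on the finitely many distances of \<open>F\<close>
  (\<open>ceiling_scaling_preserves_strict_sums\<close> and \<open>subadditive_interpolation\<close>). Composing the metric
  of \<open>QU\<close> with \<open>\<phi>\<close> restores the original distances and keeps every isometry an isometry.
\<close>

section \<open>Partial isometries\<close>

lemma isometric_embedding_imp_inj_on:
  assumes "isometric_embedding m1 m2 f"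
  shows "inj_on f (mspace m1)"
proof (rule inj_onI)
  fix x y assume xy: "x \<in> mspace m1" "y \<in> mspace m1" "f x = f y"
  then have "f y \<in> mspace m2" "mdist m1 x y = mdist m2 (f y) (f y)"
    using assms unfolding isometric_embedding_def by (blast, metis)
  then have "mdist m1 x y = 0" by simp
  then show "x = y" using xy by simp
qed

lemma PISO_iff:
  "h \<in> PISO m \<longleftrightarrow> dom h \<subseteq> mspace m \<and> ran h \<subseteq> mspace m \<and>
     (\<forall>x\<in>dom h. \<forall>y\<in>dom h. mdist m (the (h x)) (the (h y)) = mdist m x y)"
    (is "?l \<longleftrightarrow> ?r")
proof
  assume ?l
  then show ?r by (auto simp: PISO_def isometry_onto_def inf_absorb1)
next
  assume r: ?r
  then have sub: "dom h \<inter> mspace m = dom h" "ran h \<inter> mspace m = ran h" by auto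
  have img: "(the \<circ> h) ` dom h = ran h" by (force simp: ran_def)
  have "isometric_embedding (submetric m (dom h)) m (the \<circ> h)"
    using r by (auto simp: isometric_embedding_def sub ran_def)
  from isometric_embedding_imp_inj_on[OF this]
  have "inj_on (the \<circ> h) (dom h)" by (simp add: sub)
  with img have "bij_betw (the \<circ> h) (dom h) (ran h)" unfolding bij_betw_def by blast
  then show ?l using r by (simp add: PISO_def isometry_onto_def sub)
qed

lemma finite_PISO:
  assumes "finite (mspace m)"
  shows "finite (PISO m)"
proof (rule finite_subset)
  show "PISO m \<subseteq> (\<Union>A\<in>Pow (mspace m). {h. dom h = A \<and> ran h \<subseteq> mspace m})"
    by (auto simp: PISO_def)
  show "finite (\<Union>A\<in>Pow (mspace m). {h. dom h = A \<and> ran h \<subseteq> mspace m})"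
    using assms by (auto intro!: finite_set_of_finite_maps intro: finite_subset)
qed

lemma PISO_push_forward:
  assumes i: "isometric_embedding F Q \<iota>" and h: "h \<in> PISO F"
  obtains k where "k \<in> PISO Q" "dom k = \<iota> ` dom h"
    "\<And>x. x \<in> dom h \<Longrightarrow> k (\<iota> x) = Some (\<iota> (the (h x)))"
proof -
  have hF: "dom h \<subseteq> mspace F" "ran h \<subseteq> mspace F"
    and hd: "\<And>x y. x \<in> dom h \<Longrightarrow> y \<in> dom h \<Longrightarrow> mdist F (the (h x)) (the (h y)) = mdist F x y"
    using h by (auto simp: PISO_iff)
  have hr: "the (h x) \<in> mspace F" if "x \<in> dom h" for x
    using that hF by (auto simp: ran_def)
  have iQ: "\<iota> x \<in> mspace Q" if "x \<in> mspace F" for x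
    using that i by (auto simp: isometric_embedding_def)
  have id: "mdist Q (\<iota> x) (\<iota> y) = mdist F x y" if "x \<in> mspace F" "y \<in> mspace F" for x y
    using that i by (auto simp: isometric_embedding_def)
  define k where "k z = (if z \<in> \<iota> ` dom h
      then Some (\<iota> (the (h (inv_into (mspace F) \<iota> z)))) else None)" for z
  have k: "k (\<iota> x) = Some (\<iota> (the (h x)))" if "x \<in> dom h" for x
    using that hF isometric_embedding_imp_inj_on[OF i]
    by (auto simp: k_def subset_iff inv_into_f_f)
  have "k z \<noteq> None \<longleftrightarrow> z \<in> \<iota> ` dom h" for z by (simp add: k_def)
  then have dk: "dom k = \<iota> ` dom h" unfolding dom_def[of k] by blast
  have "ran k \<subseteq> mspace Q"
  proof
    fix w assume "w \<in> ran k"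
    then obtain z where z: "k z = Some w" by (auto simp: ran_def)
    then obtain x where x: "x \<in> dom h" "z = \<iota> x" using dk by blast
    then show "w \<in> mspace Q" using z k[OF x(1)] iQ[OF hr[OF x(1)]] by simp
  qed
  moreover have "\<iota> ` dom h \<subseteq> mspace Q" using iQ hF by blast
  moreover have "mdist Q (the (k z)) (the (k w)) = mdist Q z w"
    if zw: "z \<in> \<iota> ` dom h" "w \<in> \<iota> ` dom h" for z w
  proof -
    obtain x y where xy: "x \<in> dom h" "y \<in> dom h" "z = \<iota> x" "w = \<iota> y" using zw by blast
    then have "x \<in> mspace F" "y \<in> mspace F" using hF by auto
    then show ?thesis using xy by (simp add: k id hd hr)
  qed
  ultimately have "k \<in> PISO Q" unfolding PISO_iff dk by blast
  then show thesis using dk k that by blast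
qed

section \<open>Finite families of embeddings\<close>

text \<open>
  What remains of the finite group \<open>\<Gamma>\<close> for the second half of the argument: its elements \<open>\<omega>\<close>
  enter only through the embeddings \<open>a \<omega>\<close>, and right multiplication by an extension of \<open>h\<close>
  becomes the reindexing \<open>R h\<close>, which precomposes the embeddings with \<open>h\<close>.
\<close>

definition embedding_family ::
    "'a metric \<Rightarrow> 'b metric \<Rightarrow> 'i set \<Rightarrow> ('i \<Rightarrow> 'a \<Rightarrow> 'b) \<Rightarrow> (('a \<rightharpoonup> 'a) \<Rightarrow> 'i \<Rightarrow> 'i) \<Rightarrow> bool" where
  "embedding_family F Y \<Omega> a R \<longleftrightarrow>
     finite \<Omega> \<and> \<Omega> \<noteq> {} \<and> (\<forall>\<omega>\<in>\<Omega>. isometric_embedding F Y (a \<omega>)) \<and>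
     (\<forall>h\<in>PISO F. R h \<in> \<Omega> \<rightarrow> \<Omega> \<and> inj_on (R h) \<Omega> \<and>
        (\<forall>\<omega>\<in>\<Omega>. \<forall>x\<in>dom h. a (R h \<omega>) x = a \<omega> (the (h x))))"

text \<open>
  Discreteness of the topology turns density into exact agreement on \<open>F\<close>, and local finiteness
  makes the index set, the group generated by the chosen extensions, finite.
\<close>

lemma rational_embedding_family:
  fixes F :: "'f metric" and QU :: "'q metric"
  assumes QU: "rational_urysohn_space QU"
    and dense: "has_dense_locally_finite_subgroup (discrete_topology (mspace QU)) QU"
    and F: "finite (mspace F)" "rational_metric F"
  shows "\<exists>(\<Omega> :: ('q \<Rightarrow> 'q) set) a R. embedding_family F QU \<Omega> a R"
proof -
  let ?G = "ISO QU"
  interpret G: group ?G by (rule group_ISO)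
  obtain H where H: "subgroup H ?G" "locally_finite_group (?G\<lparr>carrier := H\<rparr>)"
    and cl: "ISO_topology (discrete_topology (mspace QU)) QU closure_of H = carrier ?G"
    using dense by (auto simp: has_dense_locally_finite_subgroup_def)
  let ?L = "?G\<lparr>carrier := H\<rparr>"
  have HG: "H \<subseteq> carrier ?G" using H(1) by (rule subgroup.subset)
  obtain \<iota> where i: "isometric_embedding F QU \<iota>"
    using rational_urysohn_space_universal[OF QU F] by blast
  have "\<exists>s\<in>H. \<forall>x\<in>dom h. s (\<iota> x) = \<iota> (the (h x))" if h: "h \<in> PISO F" for h
  proof -
    obtain k where k: "k \<in> PISO QU" "dom k = \<iota> ` dom h"
      "\<And>x. x \<in> dom h \<Longrightarrow> k (\<iota> x) = Some (\<iota> (the (h x)))"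
      using PISO_push_forward[OF i h] by blast
    have fin: "finite (dom k)"
      using h F(1) by (auto simp: k(2) PISO_iff intro: finite_subset)
    then obtain g where g: "g \<in> carrier ?G" "\<forall>z\<in>dom k. g z = the (k z)"
      using QU k(1) unfolding rational_urysohn_space_def ultrahomogeneous_def by blast
    have "dom k \<subseteq> mspace QU" using k(1) by (auto simp: PISO_iff)
    then obtain s where s: "s \<in> H" "\<forall>z\<in>dom k. s z = g z"
      using cl g(1) fin unfolding dense_ISO_discrete[OF HG] by blast
    then have "\<forall>x\<in>dom h. s (\<iota> x) = \<iota> (the (h x))" using g(2) k(2,3) by auto
    then show ?thesis using s(1) by blast
  qed
  then obtain s where s: "\<And>h. h \<in> PISO F \<Longrightarrow> s h \<in> H"
      "\<And>h x. h \<in> PISO F \<Longrightarrow> x \<in> dom h \<Longrightarrow> s h (\<iota> x) = \<iota> (the (h x))"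
    by metis
  define \<Gamma> where "\<Gamma> = generate ?L (s ` PISO F)"
  have grp: "group ?L" using H(2) by (simp add: locally_finite_group_def)
  have sH: "s ` PISO F \<subseteq> carrier ?L" using s(1) by auto
  have fin: "finite \<Gamma>"
    using H(2) sH finite_PISO[OF F(1)] by (simp add: locally_finite_group_def \<Gamma>_def)
  have sub: "subgroup \<Gamma> ?L"
    unfolding \<Gamma>_def using group.generate_is_subgroup[OF grp sH] .
  have \<Gamma>G: "\<gamma> \<in> carrier ?G" if "\<gamma> \<in> \<Gamma>" for \<gamma>
    using subgroup.subset[OF sub] that HG by auto
  have s\<Gamma>: "s h \<in> \<Gamma>" if "h \<in> PISO F" for h
    unfolding \<Gamma>_def using that by (intro generate.incl) auto
  have iQ: "\<iota> x \<in> mspace QU" if "x \<in> mspace F" for x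
    using that i by (auto simp: isometric_embedding_def)
  define a where "a \<gamma> x = \<gamma> (\<iota> x)" for \<gamma> :: "'q \<Rightarrow> 'q" and x
  define R where "R h \<gamma> = \<gamma> \<otimes>\<^bsub>?G\<^esub> s h" for h \<gamma>
  have "embedding_family F QU \<Gamma> a R"
    unfolding embedding_family_def
  proof (intro conjI ballI)
    show "\<Gamma> \<noteq> {}" using subgroup.one_closed[OF sub] by auto
    show "isometric_embedding F QU (a \<gamma>)" if "\<gamma> \<in> \<Gamma>" for \<gamma>
      using \<Gamma>G[OF that] i
      by (auto simp: isometric_embedding_def a_def carrier_ISO isometry_onto_def Pi_iff
          dest: bij_betwE)
  next
    fix h assume h: "h \<in> PISO F"
    show "R h \<in> \<Gamma> \<rightarrow> \<Gamma>"
      using subgroup.m_closed[OF sub _ s\<Gamma>[OF h]] by (auto simp: R_def)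
    show "inj_on (R h) \<Gamma>"
      using \<Gamma>G s\<Gamma>[OF h] by (auto simp: R_def intro!: inj_onI)
    fix \<gamma> x assume \<gamma>: "\<gamma> \<in> \<Gamma>" and x: "x \<in> dom h"
    then have "\<iota> x \<in> mspace QU" using h iQ by (auto simp: PISO_iff)
    then show "a (R h \<gamma>) x = a \<gamma> (the (h x))"
      using s(2)[OF h x] by (simp add: a_def R_def mult_ISO \<gamma> \<Gamma>G s\<Gamma>[OF h] compose_eq)
  qed (rule fin)
  then show ?thesis by blast
qed

text \<open>
  The reindexings \<open>R h\<close> for different \<open>h\<close> come from unrelated choices. Call the set of indices whose
  embeddings agree with a given map on \<open>K\<close> a fibre over \<open>K\<close>. A reindexing for \<open>h\<close> has to carry
  the fibre over \<open>ran h\<close> containing \<open>\<omega>\<close> into the fibre over \<open>dom h\<close> of maps agreeing with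
  \<open>a \<omega> \<circ> h\<close>, and apart from injectivity nothing else is asked of it. As \<open>R h\<close> is injective, the target is at least as
  large, so there is a unique reindexing that preserves the numbers given to the elements of the
  fibres. Uniqueness forces it to be functorial. The order of composition is reversed since
  embeddings are precomposed.
\<close>

lemma coherent_reindexing:
  fixes F :: "'a metric" and Y :: "'b metric" and \<Omega> :: "'i set"
  assumes fam: "embedding_family F Y \<Omega> a R"
  obtains S where "embedding_family F Y \<Omega> a S"
    "\<And>g h \<omega>. g \<in> PISO F \<Longrightarrow> h \<in> PISO F \<Longrightarrow> ran h = dom g \<Longrightarrow>
       \<omega> \<in> \<Omega> \<Longrightarrow> S (g \<circ>\<^sub>m h) \<omega> = S h (S g \<omega>)"
proof -
  have fin: "finite \<Omega>" 
    and R: "\<And>h \<omega>. h \<in> PISO F \<Longrightarrow> \<omega> \<in> \<Omega> \<Longrightarrow> R h \<omega> \<in> \<Omega>"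
      "\<And>h. h \<in> PISO F \<Longrightarrow> inj_on (R h) \<Omega>"
      "\<And>h \<omega> x. h \<in> PISO F \<Longrightarrow> \<omega> \<in> \<Omega> \<Longrightarrow> x \<in> dom h \<Longrightarrow> a (R h \<omega>) x = a \<omega> (the (h x))"
    using fam by (auto simp: embedding_family_def)
  define fib where "fib K b = {\<omega>\<in>\<Omega>. \<forall>x\<in>K. a \<omega> x = b x}" for K and b :: "'a \<Rightarrow> 'b"
  have finfib: "finite (fib K b)" for K b using fin by (simp add: fib_def)
  define en where "en C = (SOME f. bij_betw f C {0..<card C})" for C :: "'i set"
  have en: "bij_betw (en C) C {0..<card C}" if "finite C" for C :: "'i set"
    unfolding en_def using ex_bij_betw_finite_nat[OF that] by (rule someI_ex)
  (* The number of an index in its fibre over K. It depends on K and on the fibre as a set,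
     not on the map describing the fibre. *)
  define e where "e K \<omega> = en (fib K (a \<omega>)) \<omega>" for K \<omega>
  have fib_cong: "fib K b = fib K c" if "\<forall>x\<in>K. b x = c x" for K b c
    using that by (auto simp: fib_def)
  have e_bij: "bij_betw (e K) (fib K b) {0..<card (fib K b)}" for K b
  proof -
    have "e K \<omega> = en (fib K b) \<omega>" if "\<omega> \<in> fib K b" for \<omega>
      using fib_cong[of K "a \<omega>" b] that by (auto simp: e_def fib_def)
    then show ?thesis
      using en[OF finfib[of K b]] bij_betw_cong by metis
  qed
  define P where "P h \<omega> \<omega>' \<longleftrightarrow> \<omega>' \<in> \<Omega> \<and> (\<forall>x\<in>dom h. a \<omega>' x = a \<omega> (the (h x))) \<and>
      e (dom h) \<omega>' = e (ran h) \<omega>" for h \<omega> \<omega>'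
  have P_unique: "\<omega>1 = \<omega>2" if "P h \<omega> \<omega>1" "P h \<omega> \<omega>2" for h \<omega> \<omega>1 \<omega>2
  proof -
    let ?C = "fib (dom h) (\<lambda>x. a \<omega> (the (h x)))"
    have "\<omega>1 \<in> ?C" "\<omega>2 \<in> ?C" "e (dom h) \<omega>1 = e (dom h) \<omega>2"
      using that by (auto simp: P_def fib_def)
    then show ?thesis using e_bij[of "dom h"] by (auto simp: bij_betw_def dest: inj_onD)
  qed
  have P_ex: "\<exists>\<omega>'. P h \<omega> \<omega>'" if h: "h \<in> PISO F" and \<omega>: "\<omega> \<in> \<Omega>" for h \<omega>
  proof -
    let ?B = "fib (ran h) (a \<omega>)" and ?C = "fib (dom h) (\<lambda>x. a \<omega> (the (h x)))"
    have hr: "the (h x) \<in> ran h" if "x \<in> dom h" for x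
      using that by (auto simp: ran_def)
    have "R h ` ?B \<subseteq> ?C"
    proof (rule image_subsetI)
      fix \<omega>' assume "\<omega>' \<in> ?B"
      then have "\<omega>' \<in> \<Omega>" "\<forall>y\<in>ran h. a \<omega>' y = a \<omega> y" by (simp_all add: fib_def)
      then show "R h \<omega>' \<in> ?C" using R(1,3)[OF h] hr by (simp add: fib_def)
    qed
    moreover have "inj_on (R h) ?B" using R(2)[OF h] by (rule inj_on_subset) (auto simp: fib_def)
    ultimately have "card ?B \<le> card ?C" using finfib by (intro card_inj_on_le)
    moreover have "e (ran h) \<omega> < card ?B"
      using bij_betwE[OF e_bij[of "ran h" "a \<omega>"]] \<omega> by (auto simp: fib_def)
    ultimately have "e (ran h) \<omega> \<in> e (dom h) ` ?C"
      using bij_betw_imp_surj_on[OF e_bij[of "dom h"]] by simp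
    then show ?thesis by (auto simp: P_def fib_def)
  qed
  define S where "S h \<omega> = (THE \<omega>'. P h \<omega> \<omega>')" for h \<omega>
  have S_eq: "S h \<omega> = \<omega>'" if "P h \<omega> \<omega>'" for h \<omega> \<omega>'
    unfolding S_def using that P_unique by blast
  have S: "P h \<omega> (S h \<omega>)" if "h \<in> PISO F" "\<omega> \<in> \<Omega>" for h \<omega>
    using P_ex[OF that] S_eq by metis
  (* h maps onto ran h, so the restriction of S h \<omega> to dom h determines that of \<omega> to ran h. *)
  have S_inj: "inj_on (S h) \<Omega>" if h: "h \<in> PISO F" for h
  proof (rule inj_onI)
    fix \<omega>1 \<omega>2 assume \<omega>: "\<omega>1 \<in> \<Omega>" "\<omega>2 \<in> \<Omega>" "S h \<omega>1 = S h \<omega>2"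
    have "a \<omega>1 (the (h x)) = a \<omega>2 (the (h x))" if "x \<in> dom h" for x
      using S[OF h \<omega>(1)] S[OF h \<omega>(2)] \<omega>(3) that by (auto simp: P_def)
    then have "\<forall>y\<in>ran h. a \<omega>1 y = a \<omega>2 y" by (force simp: ran_def)
    then have "\<omega>1 \<in> fib (ran h) (a \<omega>2)" "\<omega>2 \<in> fib (ran h) (a \<omega>2)"
      using \<omega> by (auto simp: fib_def)
    moreover have "e (ran h) \<omega>1 = e (ran h) \<omega>2"
      using S[OF h \<omega>(1)] S[OF h \<omega>(2)] \<omega>(3) by (auto simp: P_def)
    ultimately show "\<omega>1 = \<omega>2" using e_bij[of "ran h"] by (auto simp: bij_betw_def dest: inj_onD)
  qed
  show thesis
  proof (rule that)
    show "embedding_family F Y \<Omega> a S"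
      using fam S S_inj by (auto simp: embedding_family_def P_def)
  next
    fix g h \<omega>
    assume gh: "g \<in> PISO F" "h \<in> PISO F" "ran h = dom g" and \<omega>: "\<omega> \<in> \<Omega>"
    have Pg: "P g \<omega> (S g \<omega>)" using S gh \<omega> by blast
    then have "P h (S g \<omega>) (S h (S g \<omega>))" using S gh by (auto simp: P_def)
    moreover have "dom (g \<circ>\<^sub>m h) = dom h"
      using gh(3) by (auto simp: map_comp_def dom_def ran_def split: option.splits)
    moreover have "ran (g \<circ>\<^sub>m h) = ran g"
    proof (intro equalityI subsetI)
      fix z assume "z \<in> ran g"
      then obtain y where y: "g y = Some z" by (auto simp: ran_def)
      then have "y \<in> ran h" using gh(3) by auto
      then obtain x where "h x = Some y" by (auto simp: ran_def)
      then have "(g \<circ>\<^sub>m h) x = Some z" using y by simp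
      then show "z \<in> ran (g \<circ>\<^sub>m h)" by (rule ranI)
    qed (auto simp: ran_def map_comp_Some_iff)
    moreover have "a (S g \<omega>) (the (h x)) = a \<omega> (the ((g \<circ>\<^sub>m h) x))" if x: "x \<in> dom h" for x
    proof -
      obtain y where "h x = Some y" using x by blast
      moreover have "y \<in> dom g" using \<open>h x = Some y\<close> gh(3) by (auto intro: ranI)
      ultimately show ?thesis using Pg by (simp add: P_def)
    qed
    ultimately have "P (g \<circ>\<^sub>m h) \<omega> (S h (S g \<omega>))"
      using Pg gh(3) by (simp add: P_def)
    then show "S (g \<circ>\<^sub>m h) \<omega> = S h (S g \<omega>)" by (rule S_eq)
  qed
qed

section \<open>Globalization of partial isometries\<close>

definition globalization ::
    "'a metric \<Rightarrow> 'b metric \<Rightarrow> ('a \<Rightarrow> 'b) \<Rightarrow> (('a \<rightharpoonup> 'a) \<Rightarrow> 'b \<Rightarrow> 'b) \<Rightarrow> bool" where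
  "globalization F F' I T \<longleftrightarrow>
     finite (mspace F') \<and> isometric_embedding F F' I \<and>
     T \<in> PISO F \<rightarrow> carrier (ISO F') \<and>
     (\<forall>h\<in>PISO F. \<forall>x\<in>dom h. I (the (h x)) = T h (I x)) \<and>
     (\<forall>K\<subseteq>mspace F. (\<lambda>g. T (as_partial K g)) \<in> hom (ISO (submetric F K)) (ISO F'))"

lemma globalization_transport:
  assumes gl: "globalization F X I T" and e: "isometry_onto X Y e"
  shows "\<exists>I' T'. globalization F Y I' T'"
proof -
  define i where "i = inv_into (mspace X) e"
  have b: "bij_betw e (mspace X) (mspace Y)"
    and d: "\<And>x y. x \<in> mspace X \<Longrightarrow> y \<in> mspace X \<Longrightarrow> mdist Y (e x) (e y) = mdist X x y"
    using e by (auto simp: isometry_onto_def)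
  have eY: "e x \<in> mspace Y" if "x \<in> mspace X" for x using b that by (auto dest: bij_betwE)
  have ib: "bij_betw i (mspace Y) (mspace X)" unfolding i_def by (rule bij_betw_inv_into[OF b])
  then have iX: "i y \<in> mspace X" if "y \<in> mspace Y" for y using that by (auto dest: bij_betwE)
  have ie: "i (e x) = x" if "x \<in> mspace X" for x
    using that b by (simp add: i_def bij_betw_inv_into_left)
  have ei: "e (i y) = y" if "y \<in> mspace Y" for y
    using that b by (simp add: i_def bij_betw_inv_into_right)
  have id: "mdist X (i x) (i y) = mdist Y x y" if "x \<in> mspace Y" "y \<in> mspace Y" for x y
    using d[of "i x" "i y"] that by (simp add: iX ei)
  define c where "c f = restrict (e \<circ> f \<circ> i) (mspace Y)" for f
  have c: "c f \<in> carrier (ISO Y)" if f: "f \<in> carrier (ISO X)" for f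
  proof -
    have fb: "bij_betw f (mspace X) (mspace X)"
      and fd: "\<And>x y. x \<in> mspace X \<Longrightarrow> y \<in> mspace X \<Longrightarrow> mdist X (f x) (f y) = mdist X x y"
      using f by (auto simp: carrier_ISO isometry_onto_def)
    have "bij_betw (e \<circ> f \<circ> i) (mspace Y) (mspace Y)"
      using bij_betw_trans[OF bij_betw_trans[OF ib fb] b] by (simp add: comp_assoc)
    then have "bij_betw (c f) (mspace Y) (mspace Y)"
      by (subst bij_betw_cong[of _ _ "e \<circ> f \<circ> i"]) (auto simp: c_def)
    moreover have "f (i y) \<in> mspace X" if "y \<in> mspace Y" for y
      using fb iX[OF that] by (auto dest: bij_betwE)
    ultimately show ?thesis
      by (auto simp: carrier_ISO isometry_onto_def c_def d fd iX id)
  qed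
  have c_mult: "c (f \<otimes>\<^bsub>ISO X\<^esub> g) = c f \<otimes>\<^bsub>ISO Y\<^esub> c g"
    if fg: "f \<in> carrier (ISO X)" "g \<in> carrier (ISO X)" for f g
  proof -
    have "g (i y) \<in> mspace X" if "y \<in> mspace Y" for y
      using fg(2) iX[OF that] by (auto simp: carrier_ISO isometry_onto_def dest: bij_betwE)
    then show ?thesis
      unfolding mult_ISO[OF fg] mult_ISO[OF c[OF fg(1)] c[OF fg(2)]]
      using fg by (auto simp: c_def compose_def iX ie eY fun_eq_iff carrier_ISO isometry_onto_def
          dest: bij_betwE)
  qed
  have IX: "I x \<in> mspace X" if "x \<in> mspace F" for x
    using gl that by (auto simp: globalization_def isometric_embedding_def)
  have "globalization F Y (e \<circ> I) (c \<circ> T)"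
    unfolding globalization_def
  proof (intro conjI ballI allI impI)
    show "finite (mspace Y)"
      using gl bij_betw_finite[OF b] by (simp add: globalization_def)
    show "isometric_embedding F Y (e \<circ> I)"
      using gl by (auto simp: globalization_def isometric_embedding_def eY d IX)
    show "c \<circ> T \<in> PISO F \<rightarrow> carrier (ISO Y)"
      using gl c by (simp add: globalization_def Pi_iff)
  next
    fix h x assume hx: "h \<in> PISO F" "x \<in> dom h"
    then have "x \<in> mspace F" "I (the (h x)) = T h (I x)"
      using gl by (auto simp: globalization_def PISO_iff)
    then show "(e \<circ> I) (the (h x)) = (c \<circ> T) h ((e \<circ> I) x)" by (simp add: c_def eY ie IX)
  next
    fix K assume "K \<subseteq> mspace F"
    then have "(\<lambda>g. T (as_partial K g)) \<in> hom (ISO (submetric F K)) (ISO X)"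
      using gl by (auto simp: globalization_def)
    then show "(\<lambda>g. (c \<circ> T) (as_partial K g)) \<in> hom (ISO (submetric F K)) (ISO Y)"
      by (simp add: hom_def Pi_iff c c_mult)
  qed
  then show ?thesis by blast
qed

text \<open>
  Averaging over \<open>\<Omega>\<close> is invariant under permutations of \<open>\<Omega>\<close>, and the normalization makes
  the distance of two functions equal to \<open>r\<close> when their values are at distance \<open>r\<close> everywhere.
\<close>

lemma mean_metric:
  fixes Y :: "'b metric" and \<Omega> :: "'i set"
  assumes \<Omega>: "finite \<Omega>" "\<Omega> \<noteq> {}" and A: "A \<subseteq> mspace Y"
  obtains X where "mspace X = \<Omega> \<rightarrow>\<^sub>E A"
    "\<And>f g. f \<in> \<Omega> \<rightarrow>\<^sub>E A \<Longrightarrow> g \<in> \<Omega> \<rightarrow>\<^sub>E A \<Longrightarrow>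
       mdist X f g = (\<Sum>\<omega>\<in>\<Omega>. mdist Y (f \<omega>) (g \<omega>)) / card \<Omega>"
proof -
  let ?d = "\<lambda>f g. (\<Sum>\<omega>\<in>\<Omega>. mdist Y (f \<omega>) (g \<omega>)) / card \<Omega>"
  have card: "real (card \<Omega>) > 0" using \<Omega> by (simp add: card_gt_0_iff)
  interpret Y: Metric_space "mspace Y" "mdist Y" by simp
  have M: "Metric_space (\<Omega> \<rightarrow>\<^sub>E A) ?d"
  proof
    fix f g h
    show "0 \<le> ?d f g" by (simp add: sum_nonneg)
    show "?d f g = ?d g f" by (simp add: Y.commute)
    assume f: "f \<in> \<Omega> \<rightarrow>\<^sub>E A" and g: "g \<in> \<Omega> \<rightarrow>\<^sub>E A"
    have fg: "f \<omega> \<in> mspace Y" "g \<omega> \<in> mspace Y" if "\<omega> \<in> \<Omega>" for \<omega>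
      using f g A that by auto
    have "?d f g = 0 \<longleftrightarrow> (\<forall>\<omega>\<in>\<Omega>. mdist Y (f \<omega>) (g \<omega>) = 0)"
      using \<Omega> by (simp add: sum_nonneg_eq_0_iff)
    also have "\<dots> \<longleftrightarrow> (\<forall>\<omega>\<in>\<Omega>. f \<omega> = g \<omega>)" using fg by simp
    also have "\<dots> \<longleftrightarrow> f = g" using f g by (auto intro: PiE_ext)
    finally show "?d f g = 0 \<longleftrightarrow> f = g" .
    assume h: "h \<in> \<Omega> \<rightarrow>\<^sub>E A"
    have "(\<Sum>\<omega>\<in>\<Omega>. mdist Y (f \<omega>) (h \<omega>))
        \<le> (\<Sum>\<omega>\<in>\<Omega>. mdist Y (f \<omega>) (g \<omega>) + mdist Y (g \<omega>) (h \<omega>))"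
      using fg h A by (intro sum_mono Y.triangle) auto
    then show "?d f h \<le> ?d f g + ?d g h"
      using card by (simp add: sum.distrib divide_right_mono flip: add_divide_distrib)
  qed
  show thesis
    by (rule that[of "metric (\<Omega> \<rightarrow>\<^sub>E A, ?d)"])
      (simp_all add: Metric_space.mspace_metric[OF M] Metric_space.mdist_metric[OF M])
qed

text \<open>
  Points of \<open>F\<close> become functions of the index, and \<open>h\<close> acts by permuting the indices.
  Precomposition with \<open>S h\<close> reverses the order of composition a second time, which makes \<open>T\<close> a
  homomorphism rather than an antihomomorphism.
\<close>

lemma globalization_of_embedding_family:
  assumes F: "finite (mspace F)" and fam: "embedding_family F Y \<Omega> a R"
  shows "\<exists>(F' :: nat metric) I T. globalization F F' I T"
proof -
  obtain S where S: "embedding_family F Y \<Omega> a S"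
    and Scomp: "\<And>g h \<omega>. g \<in> PISO F \<Longrightarrow> h \<in> PISO F \<Longrightarrow> ran h = dom g \<Longrightarrow>
       \<omega> \<in> \<Omega> \<Longrightarrow> S (g \<circ>\<^sub>m h) \<omega> = S h (S g \<omega>)"
    using coherent_reindexing[OF fam] by blast
  have \<Omega>: "finite \<Omega>" "\<Omega> \<noteq> {}"
    and a: "\<And>\<omega>. \<omega> \<in> \<Omega> \<Longrightarrow> isometric_embedding F Y (a \<omega>)"
    and S\<Omega>: "\<And>h. h \<in> PISO F \<Longrightarrow> S h \<in> \<Omega> \<rightarrow> \<Omega>"
    and Sinj: "\<And>h. h \<in> PISO F \<Longrightarrow> inj_on (S h) \<Omega>"
    and Sa: "\<And>h \<omega> x. h \<in> PISO F \<Longrightarrow> \<omega> \<in> \<Omega> \<Longrightarrow> x \<in> dom h \<Longrightarrow> a (S h \<omega>) x = a \<omega> (the (h x))"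
    using S by (auto simp: embedding_family_def)
  have Sbij: "bij_betw (S h) \<Omega> \<Omega>" if "h \<in> PISO F" for h
  proof -
    have "S h ` \<Omega> = \<Omega>"
      by (rule endo_inj_surj[OF \<Omega>(1) _ Sinj[OF that]]) (use S\<Omega>[OF that] in auto)
    then show ?thesis using Sinj[OF that] by (simp add: bij_betw_def)
  qed
  (* Values are confined to the points that are reached, so that the function space is finite. *)
  define A where "A = (\<Union>\<omega>\<in>\<Omega>. a \<omega> ` mspace F)"
  have AY: "A \<subseteq> mspace Y" using a by (auto simp: A_def isometric_embedding_def)
  have aA: "a \<omega> x \<in> A" if "\<omega> \<in> \<Omega>" "x \<in> mspace F" for \<omega> x using that by (auto simp: A_def)
  obtain X where X: "mspace X = \<Omega> \<rightarrow>\<^sub>E A"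
    "\<And>f g. f \<in> \<Omega> \<rightarrow>\<^sub>E A \<Longrightarrow> g \<in> \<Omega> \<rightarrow>\<^sub>E A \<Longrightarrow>
       mdist X f g = (\<Sum>\<omega>\<in>\<Omega>. mdist Y (f \<omega>) (g \<omega>)) / card \<Omega>"
    using mean_metric[OF \<Omega> AY] by blast
  have finX: "finite (mspace X)"
    using \<Omega> F by (auto simp: X(1) A_def intro!: finite_PiE)
  define I where "I x = (\<lambda>\<omega>\<in>\<Omega>. a \<omega> x)" for x
  define T where "T h = (\<lambda>f\<in>\<Omega> \<rightarrow>\<^sub>E A. \<lambda>\<omega>\<in>\<Omega>. f (S h \<omega>))" for h
  have IX: "I x \<in> \<Omega> \<rightarrow>\<^sub>E A" if "x \<in> mspace F" for x
    using that aA by (auto simp: I_def)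
  have I: "isometric_embedding F X I"
    unfolding isometric_embedding_def X(1)
  proof (intro conjI ballI)
    fix x y assume xy: "x \<in> mspace F" "y \<in> mspace F"
    have "(\<Sum>\<omega>\<in>\<Omega>. mdist Y (I x \<omega>) (I y \<omega>)) = (\<Sum>\<omega>\<in>\<Omega>. mdist F x y)"
      using xy a by (intro sum.cong) (auto simp: I_def isometric_embedding_def)
    then show "mdist X (I x) (I y) = mdist F x y"
      using \<Omega> by (simp add: X(2) IX xy)
  qed (use IX in auto)
  have TX: "T h f \<in> \<Omega> \<rightarrow>\<^sub>E A" if "h \<in> PISO F" "f \<in> \<Omega> \<rightarrow>\<^sub>E A" for h f
    using that S\<Omega>[OF that(1)] by (auto simp: T_def Pi_iff PiE_iff)
  have T: "T h \<in> carrier (ISO X)" if h: "h \<in> PISO F" for h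
  proof -
    have "inj_on (T h) (\<Omega> \<rightarrow>\<^sub>E A)"
    proof (rule inj_onI)
      fix f g assume fg: "f \<in> \<Omega> \<rightarrow>\<^sub>E A" "g \<in> \<Omega> \<rightarrow>\<^sub>E A" "T h f = T h g"
      have "f (S h \<omega>) = g (S h \<omega>)" if "\<omega> \<in> \<Omega>" for \<omega>
        using fun_cong[OF fg(3), of \<omega>] fg that by (simp add: T_def)
      moreover have "S h ` \<Omega> = \<Omega>" using Sbij[OF h] by (simp add: bij_betw_def)
      ultimately have "f \<omega> = g \<omega>" if "\<omega> \<in> \<Omega>" for \<omega> using that by force
      then show "f = g" using fg by (auto intro: PiE_ext)
    qed
    moreover from this have "T h ` (\<Omega> \<rightarrow>\<^sub>E A) = \<Omega> \<rightarrow>\<^sub>E A"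
      using TX[OF h] finX unfolding X(1) by (intro endo_inj_surj) blast+
    ultimately have "bij_betw (T h) (mspace X) (mspace X)"
      by (simp add: bij_betw_def X(1))
    moreover have "mdist X (T h f) (T h g) = mdist X f g"
      if fg: "f \<in> \<Omega> \<rightarrow>\<^sub>E A" "g \<in> \<Omega> \<rightarrow>\<^sub>E A" for f g
    proof -
      have "(\<Sum>\<omega>\<in>\<Omega>. mdist Y (T h f \<omega>) (T h g \<omega>)) = (\<Sum>\<omega>\<in>\<Omega>. mdist Y (f (S h \<omega>)) (g (S h \<omega>)))"
        using fg by (intro sum.cong) (auto simp: T_def)
      also have "\<dots> = (\<Sum>\<omega>\<in>\<Omega>. mdist Y (f \<omega>) (g \<omega>))"
        by (rule sum.reindex_bij_betw[OF Sbij[OF h]])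
      finally show ?thesis by (simp add: X(2) fg TX h)
    qed
    ultimately show ?thesis by (auto simp: carrier_ISO isometry_onto_def X(1) T_def)
  qed
  have "globalization F X I T"
    unfolding globalization_def
  proof (intro conjI ballI allI impI)
    show "T \<in> PISO F \<rightarrow> carrier (ISO X)" using T by blast
  next
    fix h x assume h: "h \<in> PISO F" and x: "x \<in> dom h"
    then have xF: "x \<in> mspace F" by (auto simp: PISO_iff)
    show "I (the (h x)) = T h (I x)"
      using IX[OF xF] S\<Omega>[OF h] by (auto simp: T_def I_def Sa h x Pi_iff fun_eq_iff)
  next
    fix K assume K: "K \<subseteq> mspace F"
    let ?G = "ISO (submetric F K)"
    have p: "as_partial K g \<in> PISO F" "dom (as_partial K g) = K" "ran (as_partial K g) = K"
      if "g \<in> carrier ?G" for g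
    proof -
      have "as_partial K g \<in> {h \<in> PISO F. dom h = K \<and> ran h = K}"
        unfolding as_partial_image_ISO[OF K, symmetric] using that by (rule imageI)
      then show "as_partial K g \<in> PISO F" "dom (as_partial K g) = K" "ran (as_partial K g) = K"
        by simp_all
    qed
    have "T (as_partial K (g \<otimes>\<^bsub>?G\<^esub> h)) = T (as_partial K g) \<otimes>\<^bsub>ISO X\<^esub> T (as_partial K h)"
      if gh: "g \<in> carrier ?G" "h \<in> carrier ?G" for g h
    proof -
      let ?g = "as_partial K g" and ?h = "as_partial K h"
      have eq: "as_partial K (g \<otimes>\<^bsub>?G\<^esub> h) = ?g \<circ>\<^sub>m ?h" by (rule as_partial_mult[OF K gh])
      have "S (?g \<circ>\<^sub>m ?h) \<omega> = S ?h (S ?g \<omega>)" if "\<omega> \<in> \<Omega>" for \<omega>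
        using that p[OF gh(1)] p[OF gh(2)] by (intro Scomp) auto
      then have "T (?g \<circ>\<^sub>m ?h) f = T ?g (T ?h f)" if "f \<in> \<Omega> \<rightarrow>\<^sub>E A" for f
        using that TX[OF p(1)[OF gh(2)] that] S\<Omega>[OF p(1)[OF gh(1)]]
        by (auto simp: T_def Pi_iff fun_eq_iff)
      then have "T (?g \<circ>\<^sub>m ?h) = compose (mspace X) (T ?g) (T ?h)"
        by (intro ext) (simp add: compose_def X(1) T_def)
      then show ?thesis
        unfolding eq mult_ISO[OF T[OF p(1)[OF gh(1)]] T[OF p(1)[OF gh(2)]]] .
    qed
    then show "(\<lambda>g. T (as_partial K g)) \<in> hom ?G (ISO X)"
      using T[OF p(1)] by (simp add: hom_def)
  qed (use finX I in auto)
  moreover obtain e :: "_ \<Rightarrow> nat" where "inj_on e (mspace X)"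
    using finite_imp_inj_to_nat_seg[OF finX] by blast
  then obtain Y' where "isometry_onto X Y' e" by (rule metric_transport)
  ultimately show ?thesis using globalization_transport by blast
qed

section \<open>Approximation by integer distances\<close>

text \<open>
  Only boundedly many summands fit below \<open>Max V\<close>, so there are finitely many strict inequalities,
  and they hold with a common gap \<open>\<delta>\<close>. Rounding costs at most one unit per summand, which is less
  than \<open>N \<delta>\<close> for large \<open>N\<close>.
\<close>

lemma ceiling_scaling_preserves_strict_sums:
  fixes V :: "real set"
  assumes V: "finite V" "V \<noteq> {}" "\<And>v. v \<in> V \<Longrightarrow> 0 < v"
  obtains N :: nat where "0 < N"
    "\<And>xs v. set xs \<subseteq> V \<Longrightarrow> v \<in> V \<Longrightarrow> sum_list xs < v \<Longrightarrow>
       (\<Sum>x\<leftarrow>xs. real_of_int \<lceil>real N * x\<rceil>) < real_of_int \<lceil>real N * v\<rceil>"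
proof -
  have minV: "0 < Min V" "\<And>v. v \<in> V \<Longrightarrow> Min V \<le> v" using V by auto
  obtain k :: nat where k: "Max V / Min V < k" using reals_Archimedean2 by blast
  have len: "length xs \<le> k" if "set xs \<subseteq> V" "v \<in> V" "sum_list xs < v" for xs v
  proof -
    have "length xs * Min V \<le> sum_list xs"
      using that(1) by (induction xs) (auto simp: algebra_simps dest!: minV(2))
    also have "\<dots> < Max V" using that V Max_ge[of V v] by linarith
    also have "\<dots> < k * Min V" using k minV(1) by (simp add: field_simps)
    finally show ?thesis using minV(1) by simp
  qed
  define D where "D = {v - sum_list xs |v xs. v \<in> V \<and> set xs \<subseteq> V \<and> length xs \<le> k \<and> sum_list xs < v}"
  have "D \<subseteq> (\<lambda>(v, xs). v - sum_list xs) ` (V \<times> {xs. set xs \<subseteq> V \<and> length xs \<le> k})"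
    by (auto simp: D_def)
  then have finD: "finite D"
    using V(1) finite_lists_length_le[OF V(1)] by (meson finite_SigmaI finite_imageI finite_subset)
  define \<delta> where "\<delta> = Min (insert 1 D)"
  have \<delta>: "0 < \<delta>" using finD by (auto simp: \<delta>_def D_def)
  have gap: "\<delta> \<le> v - sum_list xs" if "set xs \<subseteq> V" "v \<in> V" "sum_list xs < v" for xs v
    unfolding \<delta>_def using that len[OF that] finD by (intro Min_le) (auto simp: D_def)
  obtain N :: nat where N: "k / \<delta> < N" using reals_Archimedean2 by blast
  show thesis
  proof (rule that)
    show "0 < N" using N \<delta> by (metis divide_nonneg_pos of_nat_0_le_iff of_nat_0_less_iff order_le_less_trans)
  next
    fix xs :: "real list" and v assume xv: "set xs \<subseteq> V" "v \<in> V" "sum_list xs < v"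
    have "(\<Sum>x\<leftarrow>xs. real_of_int \<lceil>N * x\<rceil>) \<le> N * sum_list xs + length xs"
    proof (induction xs)
      case (Cons x xs)
      then show ?case using of_int_ceiling_le_add_one[of "N * x"] by (simp add: algebra_simps)
    qed simp
    also have "\<dots> \<le> N * (v - \<delta>) + k"
      using gap[OF xv] len[OF xv] by (intro add_mono mult_left_mono) auto
    also have "\<dots> < N * v" using N \<delta> by (simp add: field_simps)
    also have "\<dots> \<le> real_of_int \<lceil>N * v\<rceil>" by simp
    finally show "(\<Sum>x\<leftarrow>xs. real_of_int \<lceil>N * x\<rceil>) < real_of_int \<lceil>N * v\<rceil>" .
  qed
qed

text \<open>
  The function \<open>\<phi>\<close> is the cheapest price of covering a length \<open>t\<close> by pieces of length \<open>c v\<close>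
  and price \<open>v\<close>, with \<open>v\<close> in \<open>V\<close>. Concatenating coverings gives subadditivity and monotonicity
  together, and the hypothesis on \<open>c\<close> says that no covering of \<open>c v\<close> is cheaper than the single
  piece \<open>v\<close>.
\<close>

lemma subadditive_interpolation:
  fixes V :: "real set" and c :: "real \<Rightarrow> real"
  assumes V: "finite V" "V \<noteq> {}" "\<And>v. v \<in> V \<Longrightarrow> 0 < v" and c: "\<And>v. v \<in> V \<Longrightarrow> 0 < c v"
    and strict: "\<And>xs v. set xs \<subseteq> V \<Longrightarrow> v \<in> V \<Longrightarrow> sum_list xs < v \<Longrightarrow> sum_list (map c xs) < c v"
  obtains \<phi> :: "real \<Rightarrow> real" where
    "\<And>v. v \<in> V \<Longrightarrow> \<phi> (c v) = v" "\<phi> 0 = 0" "\<And>t. 0 < t \<Longrightarrow> 0 < \<phi> t"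
    "\<And>s t u. u \<le> s + t \<Longrightarrow> \<phi> u \<le> \<phi> s + \<phi> t"
proof -
  define C where "C t = {sum_list xs |xs. set xs \<subseteq> V \<and> t \<le> sum_list (map c xs)}" for t
  define \<phi> where "\<phi> t = Inf (C t)" for t
  have pos: "0 \<le> sum_list xs" if "set xs \<subseteq> V" for xs
    using that V(3) by (intro sum_list_nonneg) (auto intro: less_imp_le)
  have bdd: "bdd_below (C t)" for t using pos by (auto simp: C_def intro!: bdd_belowI[of _ 0])
  have ne: "C t \<noteq> {}" for t
  proof -
    obtain v where v: "v \<in> V" using V(2) by blast
    obtain n :: nat where "t / c v < n" using reals_Archimedean2 by blast
    then have "t \<le> n * c v" using c[OF v] by (simp add: field_simps)
    then have "sum_list (replicate n v) \<in> C t"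
      unfolding C_def using v by (auto intro!: exI[of _ "replicate n v"] simp: sum_list_replicate)
    then show ?thesis by blast
  qed
  have lower: "\<phi> t \<le> sum_list xs" if "set xs \<subseteq> V" "t \<le> sum_list (map c xs)" for t xs
    unfolding \<phi>_def using that by (intro cInf_lower bdd) (auto simp: C_def)
  have greatest: "b \<le> \<phi> t"
    if "\<And>xs. set xs \<subseteq> V \<Longrightarrow> t \<le> sum_list (map c xs) \<Longrightarrow> b \<le> sum_list xs" for b t
    unfolding \<phi>_def using that by (intro cInf_greatest ne) (auto simp: C_def)
  have nonneg: "0 \<le> \<phi> t" for t using pos by (rule greatest)
  show thesis
  proof (rule that[of \<phi>])
    fix v assume v: "v \<in> V"
    show "\<phi> (c v) = v"
    proof (rule antisym)
      show "\<phi> (c v) \<le> v" using lower[of "[v]" "c v"] v by simp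
      show "v \<le> \<phi> (c v)" using strict[OF _ v] by (intro greatest) (metis not_less)
    qed
  next
    show "\<phi> 0 = 0" using lower[of "[]" 0] nonneg[of 0] by simp
  next
    fix t :: real assume t: "0 < t"
    have "Min V \<le> \<phi> t"
    proof (rule greatest)
      fix xs assume xs: "set xs \<subseteq> V" "t \<le> sum_list (map c xs)"
      then obtain x ys where "xs = x # ys" using t by (cases xs) auto
      moreover have "Min V \<le> x" "0 \<le> sum_list ys"
        using calculation xs(1) V(1) by (auto intro: pos)
      ultimately show "Min V \<le> sum_list xs" by simp
    qed
    then show "0 < \<phi> t" using V by (metis Min_in order_less_le_trans)
  next
    fix s t u :: real assume u: "u \<le> s + t"
    have "\<phi> u - \<phi> t \<le> \<phi> s"
    proof (rule greatest)
      fix xs assume xs: "set xs \<subseteq> V" "s \<le> sum_list (map c xs)"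
      have "\<phi> u - sum_list xs \<le> \<phi> t"
      proof (rule greatest)
        fix ys assume ys: "set ys \<subseteq> V" "t \<le> sum_list (map c ys)"
        have "\<phi> u \<le> sum_list (xs @ ys)" using xs ys u by (intro lower) auto
        then show "\<phi> u - sum_list xs \<le> sum_list ys" by simp
      qed
      then show "\<phi> u - \<phi> t \<le> sum_list xs" by simp
    qed
    then show "\<phi> u \<le> \<phi> s + \<phi> t" by simp
  qed
qed

lemma rescaled_metric:
  fixes \<phi> :: "real \<Rightarrow> real"
  assumes \<phi>: "\<phi> 0 = 0" "\<And>t. 0 < t \<Longrightarrow> 0 < \<phi> t"
    "\<And>s t u. 0 \<le> s \<Longrightarrow> 0 \<le> t \<Longrightarrow> 0 \<le> u \<Longrightarrow> u \<le> s + t \<Longrightarrow> \<phi> u \<le> \<phi> s + \<phi> t"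
  obtains m' where "mspace m' = mspace m" "\<And>x y. mdist m' x y = \<phi> (mdist m x y)"
proof -
  interpret m: Metric_space "mspace m" "mdist m" by simp
  have M: "Metric_space (mspace m) (\<lambda>x y. \<phi> (mdist m x y))"
  proof
    fix x y z
    show "0 \<le> \<phi> (mdist m x y)" using \<phi>(1,2) m.nonneg[of x y] by (metis order_le_less)
    show "\<phi> (mdist m x y) = \<phi> (mdist m y x)" by (simp add: m.commute)
    assume xy: "x \<in> mspace m" "y \<in> mspace m"
    show "\<phi> (mdist m x y) = 0 \<longleftrightarrow> x = y"
      using \<phi>(1) \<phi>(2)[of "mdist m x y"] xy by force
    assume "z \<in> mspace m"
    then show "\<phi> (mdist m x z) \<le> \<phi> (mdist m x y) + \<phi> (mdist m y z)"
      using xy by (intro \<phi>(3) m.triangle) auto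
  qed
  show thesis
    by (rule that[of "metric (mspace m, \<lambda>x y. \<phi> (mdist m x y))"])
      (simp_all add: Metric_space.mspace_metric[OF M] Metric_space.mdist_metric[OF M])
qed

text \<open>
  A family of embeddings for the rounded distances serves for the true ones: the reindexings are the
  same, and the target metric is composed with the function that undoes the rounding.
\<close>

lemma real_embedding_family:
  fixes F :: "'f metric" and QU :: "'q metric"
  assumes QU: "rational_urysohn_space QU"
    and dense: "has_dense_locally_finite_subgroup (discrete_topology (mspace QU)) QU"
    and F: "finite (mspace F)"
  shows "\<exists>(Y :: 'q metric) (\<Omega> :: ('q \<Rightarrow> 'q) set) a R. embedding_family F Y \<Omega> a R"
proof -
  (* The element 1 only keeps V nonempty when F has at most one point. *)
  define V where "V = insert 1 ((\<lambda>(x, y). mdist F x y) ` (mspace F \<times> mspace F) - {0})"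
  have V: "finite V" "V \<noteq> {}" "\<And>v. v \<in> V \<Longrightarrow> 0 < v"
    using F by (auto simp: V_def order_less_le)
  obtain N :: nat where N: "0 < N" "\<And>xs v. set xs \<subseteq> V \<Longrightarrow> v \<in> V \<Longrightarrow> sum_list xs < v \<Longrightarrow>
       (\<Sum>x\<leftarrow>xs. real_of_int \<lceil>real N * x\<rceil>) < real_of_int \<lceil>real N * v\<rceil>"
    using ceiling_scaling_preserves_strict_sums[OF V] by blast
  define c where "c t = real_of_int \<lceil>N * t\<rceil>" for t :: real
  have c0: "c 0 = 0" and c_pos: "0 < t \<Longrightarrow> 0 < c t" for t using N(1) by (auto simp: c_def)
  have c_sub: "c u \<le> c s + c t" if "u \<le> s + t" for u s t
  proof -
    have "\<lceil>N * u\<rceil> \<le> \<lceil>N * s + N * t\<rceil>"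
      using that by (intro ceiling_mono) (simp add: mult_left_mono flip: distrib_left)
    also have "\<dots> \<le> \<lceil>N * s\<rceil> + \<lceil>N * t\<rceil>" by (rule ceiling_add_le)
    finally show ?thesis unfolding c_def by linarith
  qed
  obtain \<phi> where \<phi>: "\<And>v. v \<in> V \<Longrightarrow> \<phi> (c v) = v" "\<phi> 0 = 0" "\<And>t. 0 < t \<Longrightarrow> 0 < \<phi> t"
    "\<And>s t u. u \<le> s + t \<Longrightarrow> \<phi> u \<le> \<phi> s + \<phi> t"
    using subadditive_interpolation[OF V c_pos[OF V(3)] N(2)[folded c_def]] by blast
  obtain F1 where F1: "mspace F1 = mspace F" "\<And>x y. mdist F1 x y = c (mdist F x y)"
    using rescaled_metric[of c F] c0 c_pos c_sub by metis
  obtain Y where Y: "mspace Y = mspace QU" "\<And>x y. mdist Y x y = \<phi> (mdist QU x y)"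
    using rescaled_metric[of \<phi> QU] \<phi> by metis
  have "rational_metric F1" by (simp add: rational_metric_def F1 c_def)
  then obtain \<Omega> :: "('q \<Rightarrow> 'q) set" and a R where fam: "embedding_family F1 QU \<Omega> a R"
    using rational_embedding_family[OF QU dense, of F1] F F1(1) by auto
  have "PISO F \<subseteq> PISO F1" by (auto simp: PISO_iff F1)
  moreover have "isometric_embedding F Y (a \<omega>)" if "\<omega> \<in> \<Omega>" for \<omega>
  proof -
    have "\<phi> (c (mdist F x y)) = mdist F x y" if "x \<in> mspace F" "y \<in> mspace F" for x y
    proof (cases "mdist F x y = 0")
      case True
      then show ?thesis by (simp only: c0 \<phi>(2))
    next
      case False
      then show ?thesis using that by (intro \<phi>(1)) (auto simp: V_def)
    qed
    then show ?thesis
      using fam that by (auto simp: embedding_family_def isometric_embedding_def F1 Y Pi_iff)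
  qed
  ultimately have "embedding_family F Y \<Omega> a R"
    using fam unfolding embedding_family_def by blast
  then show ?thesis by blast
qed

theorem theorem2:
  fixes U :: "'u metric" and QU :: "'q metric" and F :: "'f metric"
  assumes "urysohn_space U" and "rational_urysohn_space QU"
    and "has_dense_locally_finite_subgroup (mtopology_of U) U"
    and "has_dense_locally_finite_subgroup (discrete_topology (mspace QU)) QU"
    and "finite (mspace F)"
  shows "\<exists>(F' :: nat metric) I T.
           finite (mspace F') \<and> isometric_embedding F F' I \<and>
           T \<in> PISO F \<rightarrow> carrier (ISO F') \<and>
           (\<forall>h\<in>PISO F. \<forall>x\<in>dom h. I (the (h x)) = T h (I x)) \<and>
           (\<forall>K\<subseteq>mspace F. (\<lambda>g. T (as_partial K g)) \<in> hom (ISO (submetric F K)) (ISO F'))"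
proof -
  obtain Y :: "'q metric" and \<Omega> :: "('q \<Rightarrow> 'q) set" and a R where "embedding_family F Y \<Omega> a R"
    using real_embedding_family[OF assms(2,4,5)] by blast
  from globalization_of_embedding_family[OF assms(5) this] show ?thesis
    unfolding globalization_def .
qed

end
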